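(* Consider the problem $$\max_{p_1,\dots,p_M}\ \sum_{m=1}^M\sum_{n_m=1}^{N_m}\log_2\left(1+\frac{|h_{n_m m}|^2p_m/N_m}{\sum_{l=1,\,l\ne m}^M|h_{n_m l}|^2p_l/N_l+\sigma_0^2}\right)\quad\text{s.t. } 0\le p_m\le P_m^{\max},\ m=1,\dots,M,$$ and let $\mathbf p^*=F(\mathbf p^{\max},\mathbf H)$ be the optimal power control policy, i.e. the mapping from the parameters $\mathbf p^{\max}=[P_1^{\max},\dots,P_M^{\max}]^{\sf T}$ and $\mathbf H=(\mathbf h_{mm'})_{m,m'=1}^M$ to the optimal solution $\mathbf p^*=[p_1^*,\dots,p_M^*]^{\sf T}$ of this problem. Then: (PE) $F$ is one-dimensionally permutation equivalent (1D-PE) to $\mathbf p^{\max}$ and jointly permutation equivalent (joint-PE) to $\mathbf H$: for an arbitrary permutation matrix $\mathbf\Pi$ (a common reordering of the base stations and of the subsets of users associated with them), $$\mathbf\Pi^{\sf T}\mathbf p^*=F(\mathbf\Pi^{\sf T}\mathbf p^{\max},\ \mathbf\Pi^{\sf T}\mathbf H\mathbf\Pi).$$ (PI) $F$ is one-dimensionally permutation invariant (1D-PI) to $\mathbf h_{mm'}$, $m,m'=1,\dots,M$: for arbitrary permutation matrices $\mathbf\Pi_1,\dots,\mathbf\Pi_M$, where $\mathbf\Pi_m$ reorders the users associated with base station $m$, so that every $\mathbf h_{mm'}$ becomes $\mathbf\Pi_m^{\sf T}\mathbf h_{mm'}$, $m,m'=1,\dots,M$, the optimal powers are unchanged: $$\mathbf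 p^*=F(\mathbf p^{\max},\ \mathbf\Pi_1^{\sf T}\mathbf h_{11},\dots,\mathbf\Pi_M^{\sf T}\mathbf h_{MM}),$$ where the arguments after $\mathbf p^{\max}$ stand for all the permuted blocks $\mathbf\Pi_m^{\sf T}\mathbf h_{mm'}$ of $\mathbf H$.
   Context: There are $M$ base stations (BSs). BS $m$ serves $N_m$ users and has total transmit power $p_m$, with maximum allowed power $P_m^{\max}$; $\sigma_0^2$ is the noise power. The $n$-th user associated with BS $m$ is denoted $n_m$, and $h_{n_m m'}$ is the (scalar) equivalent channel between user $n_m$ and BS $m'$. The block $\mathbf h_{mm'}=[h_{1_m m'},\dots,h_{(N_m)_m m'}]^{\sf T}$ collects the channels between the users of BS $m$ and BS $m'$; $\mathbf H$ is the $M\times M$ block matrix with $(m,m')$ block $\mathbf h_{mm'}$. A function $\mathbf Y=f(\mathbf X)$ is 1D-PI to $\mathbf X$ if $\mathbf Y=f(\mathbf\Pi^{\sf T}\mathbf X)$ for every permutation matrix $\mathbf\Pi$; it is 1D-PE to $\mathbf X$ if $\mathbf\Pi^{\sf T}\mathbf Y=f(\mathbf\Pi^{\sf T}\mathbf X)$ for every $\mathbf\Pi$; it is joint-PE to $\mathbf X$ if $\mathbf\Pi^{\sf T}\mathbf Y=f(\mathbf\Pi^{\sf T}\mathbf X\mathbf\Pi)$ for every $\mathbf\Pi$. In (PE), $\mathbf\Pi$ permutes the $M$ block rows and $M$ block columns of $\mathbf H$: the columns are reordered with the BSs, and the block rows with the user subsets, in the same way (each BS keeps its own users, so the numbers $N_m$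 are reordered along). *)

theory Defs
  imports Complex_Main "Jordan_Normal_Form.Matrix"
begin

definition permutation_mat :: "nat \<Rightarrow> 'a::zero_neq_one mat \<Rightarrow> bool" where
  "permutation_mat n P \<longleftrightarrow> P \<in> carrier_mat n n \<and>
     (\<forall>i<n. \<forall>j<n. P $$ (i,j) = 0 \<or> P $$ (i,j) = 1) \<and>
     (\<forall>i<n. \<exists>!j. j < n \<and> P $$ (i,j) = 1) \<and>
     (\<forall>j<n. \<exists>!i. i < n \<and> P $$ (i,j) = 1)"

definition perm_index :: "'a::zero_neq_one mat \<Rightarrow> nat \<Rightarrow> nat" where
  "perm_index P j = (THE i. i < dim_row P \<and> P $$ (i,j) = 1)"

text \<open>The block-level product P^T X P. The entries of X may be blocks of different sizes,
  which have no ring structure, so the product is given by the selection of blocks it performs: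
  the unique nonzero summand of the (i,j) entry of P^T X P. For matrices over a ring it is the
  library's matrix product, by lemma perm_congruence_eq below.\<close>

definition perm_congruence :: "'b::zero_neq_one mat \<Rightarrow> 'a mat \<Rightarrow> 'a mat" where
  "perm_congruence P X =
     mat (dim_col P) (dim_col P) (\<lambda>(i,j). X $$ (perm_index P i, perm_index P j))"

lemma perm_index:
  assumes "permutation_mat n P" and "j < n"
  shows "perm_index P j < n" and "i < n \<Longrightarrow> P $$ (i,j) = (if i = perm_index P j then 1 else 0)"
proof -
  have d: "dim_row P = n" and u: "\<exists>!i. i < n \<and> P $$ (i,j) = 1"
    using assms by (auto simp: permutation_mat_def)
  have t: "perm_index P j < n \<and> P $$ (perm_index P j, j) = 1"
    using theI'[OF u] by (simp add: perm_index_def d)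
  then show "perm_index P j < n" by simp
  show "P $$ (i,j) = (if i = perm_index P j then 1 else 0)" if "i < n"
  proof (cases "i = perm_index P j")
    case False
    then have "P $$ (i,j) \<noteq> 1" using u t that by blast
    then show ?thesis using False that assms by (auto simp: permutation_mat_def)
  qed (use t in simp)
qed

lemma perm_congruence_eq:
  fixes P X :: "'a::ring_1 mat"
  assumes P: "permutation_mat n P" and X: "X \<in> carrier_mat n n"
  shows "perm_congruence P X = transpose_mat P * X * P"
proof (rule eq_matI)
  have d: "P \<in> carrier_mat n n" using P by (simp add: permutation_mat_def)
  fix i j assume "i < dim_row (transpose_mat P * X * P)" "j < dim_col (transpose_mat P * X * P)"
  then have ij: "i < n" "j < n" using d by auto
  have 1: "(transpose_mat P * X) $$ (i,k) = X $$ (perm_index P i, k)" if "k < n" for k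
  proof -
    have "(transpose_mat P * X) $$ (i,k) = (\<Sum>l<n. P $$ (l,i) * X $$ (l,k))"
      using d X ij that by (auto simp: scalar_prod_def lessThan_atLeast0)
    also have "\<dots> = (\<Sum>l<n. if l = perm_index P i then X $$ (l,k) else 0)"
      using perm_index(2)[OF P ij(1)] by (intro sum.cong) auto
    finally show ?thesis using perm_index(1)[OF P ij(1)] by simp
  qed
  have "(transpose_mat P * X * P) $$ (i,j)
      = (\<Sum>k<n. (transpose_mat P * X) $$ (i,k) * P $$ (k,j))"
    using d X ij
    by (simp add: scalar_prod_def lessThan_atLeast0 del: assoc_mult_mat)
  also have "\<dots> = (\<Sum>k<n. if k = perm_index P j then X $$ (perm_index P i, k) else 0)"
    using 1 perm_index(2)[OF P ij(2)] by (intro sum.cong) auto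
  finally show "perm_congruence P X $$ (i,j) = (transpose_mat P * X * P) $$ (i,j)"
    using perm_index(1)[OF P ij(2)] d ij by (simp add: perm_congruence_def)
qed (use P in \<open>auto simp: permutation_mat_def perm_congruence_def\<close>)

text \<open>Base stations and users are numbered from 0. H is a matrix whose entries are the blocks:
  \<open>H $$ (m,m')\<close> is the vector of the channels between the users of m and base station m', and
  \<open>H $$ (m,m') $ n\<close> is the channel of the n-th user of m.\<close>

definition channel_mat :: "nat \<Rightarrow> (nat \<Rightarrow> nat) \<Rightarrow> complex vec mat \<Rightarrow> bool" where
  "channel_mat M N H \<longleftrightarrow> H \<in> carrier_mat M M \<and>
     (\<forall>m<M. \<forall>m'<M. H $$ (m,m') \<in> carrier_vec (N m))"

text \<open>The numbers of users are read off the blocks, so they move along when these are reordered.\<close>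

definition num_users :: "complex vec mat \<Rightarrow> nat \<Rightarrow> nat" where
  "num_users H m = dim_vec (H $$ (m,m))"

definition user_rate :: "real \<Rightarrow> complex vec mat \<Rightarrow> real vec \<Rightarrow> nat \<Rightarrow> nat \<Rightarrow> real" where
  "user_rate \<sigma>\<^sub>0 H p m n =
     log 2 (1 + ((cmod (H $$ (m,m) $ n))\<^sup>2 * p $ m / real (num_users H m)) /
       ((\<Sum>l\<in>{..<dim_row H} - {m}. (cmod (H $$ (m,l) $ n))\<^sup>2 * p $ l / real (num_users H l))
         + \<sigma>\<^sub>0\<^sup>2))"

definition sum_rate :: "real \<Rightarrow> complex vec mat \<Rightarrow> real vec \<Rightarrow> real" where
  "sum_rate \<sigma>\<^sub>0 H p = (\<Sum>m<dim_row H. \<Sum>n<num_users H m. user_rate \<sigma>\<^sub>0 H p m n)"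

definition feasible_powers :: "real vec \<Rightarrow> real vec set" where
  "feasible_powers pmax =
     {p \<in> carrier_vec (dim_vec pmax). \<forall>m<dim_vec pmax. 0 \<le> p $ m \<and> p $ m \<le> pmax $ m}"

definition optimal_powers :: "real \<Rightarrow> real vec \<Rightarrow> complex vec mat \<Rightarrow> real vec set" where
  "optimal_powers \<sigma>\<^sub>0 pmax H =
     {p \<in> feasible_powers pmax. \<forall>q\<in>feasible_powers pmax. sum_rate \<sigma>\<^sub>0 H q \<le> sum_rate \<sigma>\<^sub>0 H p}"

text \<open>The problem is not concave and may have several optimal solutions. The policy as a
  vector-valued map is meaningful only where the solution is unique; as a set-valued map it is
  \<open>optimal_powers\<close>.\<close>

definition power_policy :: "real \<Rightarrow> real vec \<Rightarrow> complex vec mat \<Rightarrow> real vec" where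
  "power_policy \<sigma>\<^sub>0 pmax H = (THE p. p \<in> optimal_powers \<sigma>\<^sub>0 pmax H)"

definition permute_users :: "(nat \<Rightarrow> complex mat) \<Rightarrow> complex vec mat \<Rightarrow> complex vec mat" where
  "permute_users Q H =
     mat (dim_row H) (dim_col H) (\<lambda>(m,m'). transpose_mat (Q m) *\<^sub>v (H $$ (m,m')))"

end

theory Submission
  imports Defs
begin

text \<open>Renumbering base stations or users only renames summation indices and constraints. A
  permutation matrix \<open>P\<close> encodes the bijection s = \<open>perm_index P\<close> of the
  indices, and multiplying a vector by its transpose substitutes s in the index
  (\<open>transpose_permutation_mat_mult_vec_index\<close>). For a renumbering of base stations, the
  box constraints are carried along coordinate by coordinate, so the map p -> P^T p sends the
  feasible set onto the new feasible set (\<open>feasible_powers_permute\<close>), and it preserves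
  the objective because both the sum over stations and the interference sums are reindexed by s
  (\<open>sum_rate_perm_congruence\<close>). A surjection between feasible sets that preserves the
  objective maps the set of maximizers onto the set of maximizers. For a renumbering of users, the
  feasible set stays the same and only the inner sum over the users of each station is reindexed
  (\<open>sum_rate_permute_users\<close>), so the maximizers are the same. When the maximizer is
  unique, the equations between sets become equations between values of the policy.\<close>

lemma bij_betw_perm_index:
  assumes P: "permutation_mat n P"
  shows "bij_betw (perm_index P) {..<n} {..<n}"
proof (rule bij_betw_imageI)
  have one: "P $$ (perm_index P j, j) = 1" if "j < n" for j
    using perm_index[OF P that] by simp
  show inj: "inj_on (perm_index P) {..<n}"
  proof (rule inj_onI)
    fix j k assume jk: "j \<in> {..<n}" "k \<in> {..<n}" and eq: "perm_index P j = perm_index P k"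
    \<comment> \<open>If s takes the same value at \<open>j\<close> and \<open>k\<close>, both
      columns have their 1 in the same row, and a row has only one.\<close>
    have "\<exists>!l. l < n \<and> P $$ (perm_index P j, l) = 1"
      using P perm_index(1)[OF P, of j] jk by (auto simp: permutation_mat_def)
    then show "j = k"
      using one[of j] one[of k] jk eq by (metis lessThan_iff)
  qed
  show "perm_index P ` {..<n} = {..<n}"
    by (rule endo_inj_surj) (use perm_index(1)[OF P] inj in auto)
qed

lemma dim_permutation_mat:
  assumes "permutation_mat n P"
  shows "dim_row P = n" "dim_col P = n"
  using assms by (auto simp: permutation_mat_def)

text \<open>Column \<open>j\<close> of \<open>P\<close> has its only 1 in row s(j), so the scalar
  product collapses to one term. From here on matrix products are handled as index
  substitutions.\<close>

lemma transpose_permutation_mat_mult_vec_index: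
  fixes P :: "'a::comm_ring_1 mat"
  assumes P: "permutation_mat n P" and v: "v \<in> carrier_vec n" and j: "j < n"
  shows "(transpose_mat P *\<^sub>v v) $ j = v $ perm_index P j"
proof -
  have "(transpose_mat P *\<^sub>v v) $ j = (\<Sum>i<n. P $$ (i,j) * v $ i)"
    using dim_permutation_mat[OF P] v j by (auto simp: scalar_prod_def lessThan_atLeast0)
  also have "\<dots> = (\<Sum>i<n. if i = perm_index P j then v $ i else 0)"
    using perm_index(2)[OF P j] by (intro sum.cong) auto
  finally show ?thesis using perm_index(1)[OF P j] by simp
qed

text \<open>Provides the surjectivity by which every power vector of the renumbered problem comes
  from one of the original problem.\<close>

lemma bij_betw_transpose_permutation_mat:
  fixes P :: "'a::comm_ring_1 mat"
  assumes P: "permutation_mat n P"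
  shows "bij_betw (\<lambda>v. transpose_mat P *\<^sub>v v) (carrier_vec n) (carrier_vec n)"
proof -
  let ?s = "perm_index P" and ?t = "the_inv_into {..<n} (perm_index P)"
  have s: "bij_betw ?s {..<n} {..<n}" by (rule bij_betw_perm_index[OF P])
  have st: "?s (?t i) = i" "?t i < n" if "i < n" for i
    using f_the_inv_into_f_bij_betw[OF s] bij_betwE[OF bij_betw_the_inv_into[OF s]] that by auto
  have ts: "?t (?s i) = i" if "i < n" for i
    using the_inv_into_f_f[OF bij_betw_imp_inj_on[OF s]] that by auto
  have sn: "?s i < n" if "i < n" for i using perm_index(1)[OF P that] .
  note [simp] = dim_permutation_mat[OF P]
  show ?thesis
  \<comment> \<open>The inverse substitutes the inverse of s in the index.\<close>
  proof (rule bij_betw_byWitness[where f' = "\<lambda>v. vec n (\<lambda>i. v $ ?t i)"])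
    show "\<forall>v\<in>carrier_vec n. vec n (\<lambda>i. (transpose_mat P *\<^sub>v v) $ ?t i) = v"
      by (auto intro!: eq_vecI simp: transpose_permutation_mat_mult_vec_index[OF P] st
          simp del: index_mult_mat_vec)
    show "\<forall>v\<in>carrier_vec n. transpose_mat P *\<^sub>v vec n (\<lambda>i. v $ ?t i) = v"
      by (auto intro!: eq_vecI simp: transpose_permutation_mat_mult_vec_index[OF P] ts sn
          simp del: index_mult_mat_vec)
  qed (auto intro!: carrier_vecI)
qed

lemma feasible_powers_carrier: "p \<in> feasible_powers pmax \<Longrightarrow> p \<in> carrier_vec (dim_vec pmax)"
  by (simp add: feasible_powers_def)

text \<open>Constraint \<open>j\<close> of the renumbered problem is constraint s(j) of the original
  one; since s is onto, all the original constraints occur.\<close>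

lemma feasible_powers_permute_iff:
  assumes P: "permutation_mat n P" and pmax: "pmax \<in> carrier_vec n" and p: "p \<in> carrier_vec n"
  shows "transpose_mat P *\<^sub>v p \<in> feasible_powers (transpose_mat P *\<^sub>v pmax)
    \<longleftrightarrow> p \<in> feasible_powers pmax"
proof -
  let ?ok = "\<lambda>i. 0 \<le> p $ i \<and> p $ i \<le> pmax $ i"
  have d: "dim_vec (transpose_mat P *\<^sub>v pmax) = n" "transpose_mat P *\<^sub>v p \<in> carrier_vec n"
    by (simp_all add: carrier_dim_vec dim_permutation_mat[OF P])
  have "transpose_mat P *\<^sub>v p \<in> feasible_powers (transpose_mat P *\<^sub>v pmax)
      \<longleftrightarrow> (\<forall>j<n. ?ok (perm_index P j))"
    by (simp only: feasible_powers_def d mem_Collect_eq simp_thms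
        transpose_permutation_mat_mult_vec_index[OF P pmax]
        transpose_permutation_mat_mult_vec_index[OF P p] cong: imp_cong)
  also have "\<dots> \<longleftrightarrow> (\<forall>i\<in>perm_index P ` {..<n}. ?ok i)" by blast
  also have "\<dots> \<longleftrightarrow> (\<forall>i<n. ?ok i)"
    by (simp only: bij_betw_imp_surj_on[OF bij_betw_perm_index[OF P]] Ball_def lessThan_iff)
  also have "\<dots> \<longleftrightarrow> p \<in> feasible_powers pmax"
    by (simp only: feasible_powers_def carrier_vecD[OF pmax] p mem_Collect_eq simp_thms)
  finally show ?thesis .
qed

lemma feasible_powers_permute:
  assumes P: "permutation_mat n P" and pmax: "pmax \<in> carrier_vec n"
  shows "feasible_powers (transpose_mat P *\<^sub>v pmax)
    = (\<lambda>p. transpose_mat P *\<^sub>v p) ` feasible_powers pmax"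
proof -
  have image: "(\<lambda>p. transpose_mat P *\<^sub>v p) ` carrier_vec n = carrier_vec n"
    by (rule bij_betw_imp_surj_on[OF bij_betw_transpose_permutation_mat[OF P]])
  show ?thesis
  proof (intro equalityI subsetI)
    fix q assume q: "q \<in> feasible_powers (transpose_mat P *\<^sub>v pmax)"
    then have "q \<in> (\<lambda>p. transpose_mat P *\<^sub>v p) ` carrier_vec n"
      using feasible_powers_carrier[OF q] by (simp add: image dim_permutation_mat[OF P])
    then obtain p where "p \<in> carrier_vec n" "q = transpose_mat P *\<^sub>v p" by (rule imageE)
    with q show "q \<in> (\<lambda>p. transpose_mat P *\<^sub>v p) ` feasible_powers pmax"
      using feasible_powers_permute_iff[OF P pmax] by (metis imageI)
  next
    fix q assume "q \<in> (\<lambda>p. transpose_mat P *\<^sub>v p) ` feasible_powers pmax"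
    then obtain p where p: "p \<in> feasible_powers pmax" and q: "q = transpose_mat P *\<^sub>v p"
      by (rule imageE)
    have "p \<in> carrier_vec n"
      using feasible_powers_carrier[OF p] carrier_vecD[OF pmax] by simp
    then show "q \<in> feasible_powers (transpose_mat P *\<^sub>v pmax)"
      using p by (simp only: q feasible_powers_permute_iff[OF P pmax])
  qed
qed

lemma num_users_perm_congruence:
  assumes "permutation_mat n P" and "m < n"
  shows "num_users (perm_congruence P H) m = num_users H (perm_index P m)"
  using assms(2) by (simp add: num_users_def perm_congruence_def dim_permutation_mat[OF assms(1)])

text \<open>Signal, interference and user counts all move together: the counts are read off the
  diagonal blocks, so the division of the power among users follows the stations.\<close>

lemma user_rate_perm_congruence:
  assumes P: "permutation_mat n P" and H: "dim_row H = n" and p: "p \<in> carrier_vec n"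
    and m: "m < n"
  shows "user_rate \<sigma>\<^sub>0 (perm_congruence P H) (transpose_mat P *\<^sub>v p) m k
    = user_rate \<sigma>\<^sub>0 H p (perm_index P m) k"
proof -
  let ?s = "perm_index P" and ?H = "perm_congruence P H" and ?p = "transpose_mat P *\<^sub>v p"
  have s: "bij_betw ?s {..<n} {..<n}" by (rule bij_betw_perm_index[OF P])
  have entry: "?H $$ (i,j) = H $$ (?s i, ?s j)" if "i < n" "j < n" for i j
    using that by (simp add: perm_congruence_def dim_permutation_mat[OF P])
  \<comment> \<open>The serving station is left out of the interference, and s takes the left-out
    index \<open>m\<close> to the left-out index s(m).\<close>
  have "bij_betw ?s ({..<n} - {m}) ({..<n} - {?s m})"
    using bij_betw_DiffI[OF s, of "{m}" "{?s m}"] m perm_index(1)[OF P m] by simp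
  then have "(\<Sum>l\<in>{..<n} - {m}. (cmod (H $$ (?s m, ?s l) $ k))\<^sup>2 * p $ ?s l / real (num_users H (?s l)))
      = (\<Sum>l\<in>{..<n} - {?s m}. (cmod (H $$ (?s m, l) $ k))\<^sup>2 * p $ l / real (num_users H l))"
    by (rule sum.reindex_bij_betw)
  moreover have "(\<Sum>l\<in>{..<n} - {m}. (cmod (?H $$ (m,l) $ k))\<^sup>2 * ?p $ l / real (num_users ?H l))
      = (\<Sum>l\<in>{..<n} - {m}. (cmod (H $$ (?s m, ?s l) $ k))\<^sup>2 * p $ ?s l / real (num_users H (?s l)))"
    using m by (intro sum.cong) (simp_all add: entry num_users_perm_congruence[OF P]
        transpose_permutation_mat_mult_vec_index[OF P p] del: index_mult_mat_vec)
  moreover have "dim_row ?H = n" by (simp add: perm_congruence_def dim_permutation_mat[OF P])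
  ultimately show ?thesis
    by (simp only: user_rate_def H entry[OF m m] transpose_permutation_mat_mult_vec_index[OF P p m]
        num_users_perm_congruence[OF P m])
qed

lemma sum_rate_perm_congruence:
  assumes P: "permutation_mat n P" and H: "dim_row H = n" and p: "p \<in> carrier_vec n"
  shows "sum_rate \<sigma>\<^sub>0 (perm_congruence P H) (transpose_mat P *\<^sub>v p) = sum_rate \<sigma>\<^sub>0 H p"
proof -
  let ?R = "\<lambda>m. \<Sum>k<num_users H m. user_rate \<sigma>\<^sub>0 H p m k"
  have "dim_row (perm_congruence P H) = n" by (simp add: perm_congruence_def dim_permutation_mat[OF P])
  then have "sum_rate \<sigma>\<^sub>0 (perm_congruence P H) (transpose_mat P *\<^sub>v p)
      = (\<Sum>m<n. ?R (perm_index P m))"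
    by (simp add: sum_rate_def num_users_perm_congruence[OF P] user_rate_perm_congruence[OF P H p])
  also have "\<dots> = (\<Sum>m<n. ?R m)"
    by (rule sum.reindex_bij_betw[OF bij_betw_perm_index[OF P]])
  finally show ?thesis by (simp add: sum_rate_def H)
qed

lemma optimal_powers_perm_congruence:
  assumes P: "permutation_mat n P" and H: "dim_row H = n" and pmax: "pmax \<in> carrier_vec n"
  shows "optimal_powers \<sigma>\<^sub>0 (transpose_mat P *\<^sub>v pmax) (perm_congruence P H)
    = (\<lambda>p. transpose_mat P *\<^sub>v p) ` optimal_powers \<sigma>\<^sub>0 pmax H"
proof -
  have "sum_rate \<sigma>\<^sub>0 (perm_congruence P H) (transpose_mat P *\<^sub>v p) = sum_rate \<sigma>\<^sub>0 H p"
    if "p \<in> feasible_powers pmax" for p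
    using sum_rate_perm_congruence[OF P H] feasible_powers_carrier[OF that] pmax by simp
  then show ?thesis
    unfolding optimal_powers_def feasible_powers_permute[OF P pmax] by auto
qed

text \<open>Within block row \<open>m\<close>, every block is permuted by the same
  \<open>Q m\<close>, so the k-th user of \<open>m\<close> takes over all the channels, wanted and
  interfering, of one and the same old user. The rates within each cell are thus merely
  reordered.\<close>

lemma sum_rate_permute_users:
  assumes H: "channel_mat M N H" and Q: "\<And>m. m < M \<Longrightarrow> permutation_mat (N m) (Q m)"
  shows "sum_rate \<sigma>\<^sub>0 (permute_users Q H) p = sum_rate \<sigma>\<^sub>0 H p"
proof -
  let ?H = "permute_users Q H"
  have d: "dim_row H = M" "dim_col H = M" and dQ: "dim_row ?H = M"
    and blk: "\<And>m m'. m < M \<Longrightarrow> m' < M \<Longrightarrow> H $$ (m,m') \<in> carrier_vec (N m)"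
    using H by (auto simp: channel_mat_def permute_users_def)
  have num: "num_users H m = N m" if "m < M" for m
    using blk[OF that that] by (simp add: num_users_def)
  have numQ: "num_users ?H m = N m" if "m < M" for m
    using dim_permutation_mat[OF Q[OF that]] that by (simp add: num_users_def permute_users_def d)
  have entry: "?H $$ (m,l) $ k = H $$ (m,l) $ perm_index (Q m) k"
    if "m < M" "l < M" "k < N m" for m l k
    using transpose_permutation_mat_mult_vec_index[OF Q[OF that(1)] blk[OF that(1,2)] that(3)]
      that(1,2) by (simp add: permute_users_def d)
  have rate: "user_rate \<sigma>\<^sub>0 ?H p m k = user_rate \<sigma>\<^sub>0 H p m (perm_index (Q m) k)"
    if m: "m < M" and k: "k < N m" for m k
  proof -
    have "(\<Sum>l\<in>{..<M} - {m}. (cmod (?H $$ (m,l) $ k))\<^sup>2 * p $ l / real (num_users ?H l))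
        = (\<Sum>l\<in>{..<M} - {m}. (cmod (H $$ (m,l) $ perm_index (Q m) k))\<^sup>2 * p $ l / real (num_users H l))"
      using m k by (intro sum.cong) (auto simp: entry num numQ)
    then show ?thesis
      by (simp only: user_rate_def d dQ entry[OF m m k] num[OF m] numQ[OF m])
  qed
  have "(\<Sum>k<N m. user_rate \<sigma>\<^sub>0 ?H p m k) = (\<Sum>k<N m. user_rate \<sigma>\<^sub>0 H p m k)" if m: "m < M" for m
  proof -
    have "(\<Sum>k<N m. user_rate \<sigma>\<^sub>0 ?H p m k)
        = (\<Sum>k<N m. user_rate \<sigma>\<^sub>0 H p m (perm_index (Q m) k))"
      using rate[OF m] by simp
    also have "\<dots> = (\<Sum>k<N m. user_rate \<sigma>\<^sub>0 H p m k)"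
      by (rule sum.reindex_bij_betw[OF bij_betw_perm_index[OF Q[OF m]]])
    finally show ?thesis .
  qed
  then show ?thesis by (simp add: sum_rate_def d dQ num numQ)
qed

theorem mainTheorem1:
  fixes M :: nat and N :: "nat \<Rightarrow> nat" and \<sigma>\<^sub>0 :: real
    and pmax :: "real vec" and H :: "complex vec mat"
  assumes "\<sigma>\<^sub>0 > 0"
    and "\<forall>m<M. N m \<ge> 1"
    and "pmax \<in> carrier_vec M"
    and "channel_mat M N H"
  shows "(\<forall>P :: real mat. permutation_mat M P \<longrightarrow>
      optimal_powers \<sigma>\<^sub>0 (transpose_mat P *\<^sub>v pmax) (perm_congruence P H)
        = (\<lambda>p. transpose_mat P *\<^sub>v p) ` optimal_powers \<sigma>\<^sub>0 pmax H \<and>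
      ((\<exists>!p. p \<in> optimal_powers \<sigma>\<^sub>0 pmax H) \<longrightarrow>
        transpose_mat P *\<^sub>v power_policy \<sigma>\<^sub>0 pmax H
          = power_policy \<sigma>\<^sub>0 (transpose_mat P *\<^sub>v pmax) (perm_congruence P H)))
    \<and> (\<forall>Q :: nat \<Rightarrow> complex mat. (\<forall>m<M. permutation_mat (N m) (Q m)) \<longrightarrow>
      optimal_powers \<sigma>\<^sub>0 pmax (permute_users Q H) = optimal_powers \<sigma>\<^sub>0 pmax H \<and>
      ((\<exists>!p. p \<in> optimal_powers \<sigma>\<^sub>0 pmax H) \<longrightarrow>
        power_policy \<sigma>\<^sub>0 pmax H = power_policy \<sigma>\<^sub>0 pmax (permute_users Q H)))"
proof (intro conjI allI impI)
  have H: "dim_row H = M" using assms(4) by (auto simp: channel_mat_def)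
  {
    fix P :: "real mat" assume P: "permutation_mat M P"
    show opt: "optimal_powers \<sigma>\<^sub>0 (transpose_mat P *\<^sub>v pmax) (perm_congruence P H)
        = (\<lambda>p. transpose_mat P *\<^sub>v p) ` optimal_powers \<sigma>\<^sub>0 pmax H"
      by (rule optimal_powers_perm_congruence[OF P H assms(3)])
    assume "\<exists>!p. p \<in> optimal_powers \<sigma>\<^sub>0 pmax H"
    \<comment> \<open>The image of a singleton is a singleton, so the definite descriptions on both
      sides can be evaluated.\<close>
    then obtain p where p: "optimal_powers \<sigma>\<^sub>0 pmax H = {p}" by auto
    show "transpose_mat P *\<^sub>v power_policy \<sigma>\<^sub>0 pmax H
        = power_policy \<sigma>\<^sub>0 (transpose_mat P *\<^sub>v pmax) (perm_congruence P H)"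
      by (simp add: power_policy_def opt p)
  next
    fix Q :: "nat \<Rightarrow> complex mat" assume Q: "\<forall>m<M. permutation_mat (N m) (Q m)"
    show opt: "optimal_powers \<sigma>\<^sub>0 pmax (permute_users Q H) = optimal_powers \<sigma>\<^sub>0 pmax H"
      using sum_rate_permute_users[OF assms(4)] Q by (simp add: optimal_powers_def)
    show "power_policy \<sigma>\<^sub>0 pmax H = power_policy \<sigma>\<^sub>0 pmax (permute_users Q H)"
      by (simp add: power_policy_def opt)
  }
qed

end
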